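(* Fix positive integers $r,s$. Let $\sigma_0\in\mathbf{Rec}$ be any state and set $\sigma_t=(x(t),y(t),z(t))=f_{r,s}(\sigma_{t-1})$ for $t\ge1$. Then $|x(t)\sqrt{s}+y(t)\sqrt{r}|$ is bounded independently of $t$. Specifically, for every $\epsilon>0$ there exists $N\in\mathbb{N}$ such that for all $t>N$, $$-\frac{(r-2)\sqrt{s}+s\sqrt{r}+\epsilon}{2}<x(t)\sqrt{s}+y(t)\sqrt{r}<\frac{(r+2)\sqrt{s}+s\sqrt{r}+\epsilon}{2}.$$
   Context: Fix positive integers $r,s$. In the one-dimensional generalized rotor-router model, a particle starts at $0$, at each occupied site moves left if the label there is $L$ and right if it is $R$, then flips that label; on first reaching an unoccupied site to the left (resp. right) of the occupied interval, $r$ (resp. $s$) new consecutive sites on that side become occupied, labeled $R$; this defines the map $f_{r,s}$. The recurrent states $\mathbf{Rec}$ are identified with integer triples $(x,y,z)$, $x\le0\le y$, $x\le z\le y$ (the state with occupied interval $[x,y+s-1]$, labels $R$ on $[x,z-1]$, $L$ on $[z,y-1]$, $R$ on $[y,y+s-1]$); on them $f_{r,s}(x,y,z)=(x,y+s,z-y)$ if $x+y\le z$ and $f_{r,s}(x,y,z)=(x-r,y,z-x+1)$ if $x+y>z$. *)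

theory Defs
  imports Complex_Main
begin

datatype label = L | R

text \<open>A state is the partial labelling of the integers; its domain is the set of occupied sites.\<close>

type_synonym state = "int \<rightharpoonup> label"

fun rotor_step :: "int \<times> state \<Rightarrow> int \<times> state" where
  "rotor_step (p, \<sigma>) =
    (case \<sigma> p of
       None \<Rightarrow> (p, \<sigma>)
     | Some L \<Rightarrow> (p - 1, \<sigma>(p \<mapsto> R))
     | Some R \<Rightarrow> (p + 1, \<sigma>(p \<mapsto> L)))"

text \<open>Steps preserve the domain, so \<open>dom \<sigma>\<close> is the occupied set throughout the walk.\<close>

definition exit_time :: "state \<Rightarrow> nat" where
  "exit_time \<sigma> = (LEAST n. fst ((rotor_step ^^ n) (0, \<sigma>)) \<notin> dom \<sigma>)"

definition occupy :: "int set \<Rightarrow> state \<Rightarrow> state" where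
  "occupy A \<sigma> = (\<lambda>q. if q \<in> A then Some R else \<sigma> q)"

definition rotor_map :: "nat \<Rightarrow> nat \<Rightarrow> state \<Rightarrow> state" where
  "rotor_map r s \<sigma> =
    (let (p, \<tau>) = (rotor_step ^^ exit_time \<sigma>) (0, \<sigma>)
     in if \<forall>q\<in>dom \<sigma>. p < q
        then occupy {p - int r + 1 .. p} \<tau>
        else occupy {p .. p + int s - 1} \<tau>)"

definition rec_triples :: "(int \<times> int \<times> int) set" where
  "rec_triples = {(x, y, z). x \<le> 0 \<and> 0 \<le> y \<and> x \<le> z \<and> z \<le> y}"

definition rec_state :: "nat \<Rightarrow> int \<times> int \<times> int \<Rightarrow> state" where
  "rec_state s = (\<lambda>(x, y, z) p.
     if p \<in> {x .. z - 1} then Some R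
     else if p \<in> {z .. y - 1} then Some L
     else if p \<in> {y .. y + int s - 1} then Some R
     else None)"

definition Rec :: "nat \<Rightarrow> state set" where
  "Rec s = rec_state s ` rec_triples"

text \<open>The identification of \<open>Rec s\<close> with triples: the inverse of the encoding, which is
  injective on \<open>rec_triples\<close> for \<open>s > 0\<close> (lemma below).\<close>

definition rec_coords :: "nat \<Rightarrow> state \<Rightarrow> int \<times> int \<times> int" where
  "rec_coords s = inv_into rec_triples (rec_state s)"

lemma dom_rec_state:
  assumes "(x, y, z) \<in> rec_triples"
  shows "dom (rec_state s (x, y, z)) = {x .. y + int s - 1}"
  using assms by (auto simp: rec_state_def rec_triples_def split: if_splits)

lemma inj_on_rec_state:
  assumes "s > 0"
  shows "inj_on (rec_state s) rec_triples"
proof (rule inj_onI, unfold split_paired_all)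
  fix x y z x' y' z'
  assume T: "(x, y, z) \<in> rec_triples" "(x', y', z') \<in> rec_triples"
    and eq: "rec_state s (x, y, z) = rec_state s (x', y', z')"
  have "{x .. y + int s - 1} = {x' .. y' + int s - 1}"
    using dom_rec_state[OF T(1)] dom_rec_state[OF T(2)] eq by metis
  moreover have "x \<le> y + int s - 1" using T(1) assms by (auto simp: rec_triples_def)
  ultimately have xy: "x = x'" "y = y'" by (auto simp: Icc_eq_Icc)
  have "z = z'"
  proof (rule ccontr)
    assume "z \<noteq> z'"
    moreover have "rec_state s (x, y, z) (min z z') = rec_state s (x, y, z') (min z z')"
      using eq xy by simp
    ultimately show False
      using T xy by (auto simp: rec_state_def rec_triples_def min_def split: if_splits)
  qed
  with xy show "(x, y, z) = (x', y', z')" by simp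
qed

lemma rec_coords_rec_state:
  "s > 0 \<Longrightarrow> T \<in> rec_triples \<Longrightarrow> rec_coords s (rec_state s T) = T"
  by (simp add: rec_coords_def inj_on_rec_state)

end

theory Submission
  imports Defs
begin

text \<open>
  The map \<open>f\<close> on triples preserves
  \<open>J = 2rsz + ry\<^sup>2 - rsy - sx\<^sup>2 + 2sx - rsx\<close>. Put \<open>u = y\<surd>r + x\<surd>s\<close> and \<open>S = y\<surd>r - x\<surd>s\<close>, so that
  \<open>uS = ry\<^sup>2 - sx\<^sup>2\<close>. Since \<open>x \<le> z \<le> y\<close>, the invariant bounds \<open>uS\<close> above and below by expressions
  that are linear in \<open>u\<close> and \<open>S\<close>; as \<open>S\<close> tends to infinity, dividing by \<open>S\<close> gives the asymptotic
  bounds on \<open>u\<close>.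

  That the walk realises \<open>f\<close> is seen by following its turning points: when the particle turns left
  at site \<open>k\<close>, the first \<open>L\<close> is at \<open>z - k\<close>, and the next left turn is at \<open>k + 1\<close>. Hence it leaves on
  the right if \<open>k\<close> reaches \<open>y\<close> while \<open>z - k \<ge> x\<close>, and on the left otherwise.
\<close>

section \<open>Sweeps and turning points of the walk\<close>

definition reaches :: "int \<times> state \<Rightarrow> int \<times> state \<Rightarrow> bool" where
  "reaches c d \<longleftrightarrow> (\<exists>n. (rotor_step ^^ n) c = d)"

lemma reaches_refl: "reaches c c"
  unfolding reaches_def by (rule exI[of _ 0]) simp

lemma reaches_trans [trans]:
  assumes "reaches c d" "reaches d e"
  shows "reaches c e"
proof -
  obtain m n where "(rotor_step ^^ m) c = d" "(rotor_step ^^ n) d = e"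
    using assms unfolding reaches_def by blast
  then have "(rotor_step ^^ (n + m)) c = e" by (simp add: funpow_add)
  then show ?thesis unfolding reaches_def by blast
qed

lemma sweep_right:
  assumes "\<forall>q\<in>{p..<p + int n}. \<sigma> q = Some R"
  shows "(rotor_step ^^ n) (p, \<sigma>) =
    (p + int n, \<lambda>q. if q \<in> {p..<p + int n} then Some L else \<sigma> q)"
  using assms
proof (induction n)
  case (Suc n)
  then show ?case by (auto simp: fun_eq_iff)
qed simp

lemma sweep_left:
  assumes "\<forall>q\<in>{p - int n<..p}. \<sigma> q = Some L"
  shows "(rotor_step ^^ n) (p, \<sigma>) =
    (p - int n, \<lambda>q. if q \<in> {p - int n<..p} then Some R else \<sigma> q)"
  using assms
proof (induction n)
  case (Suc n)
  then show ?case by (auto simp: fun_eq_iff)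
qed simp

text \<open>A sweep over the \<open>R\<close> labels from \<open>q\<close> up to the first
  \<open>L\<close> at \<open>w\<close> turns them into \<open>L\<close>, so the particle and the
  \<open>R\<close>/\<open>L\<close> boundary exchange places and the labelling keeps the form
  \<open>rec_state\<close>.\<close>

lemma reaches_right:
  assumes "x \<le> q" "q \<le> w" "w \<le> y"
  shows "reaches (q, rec_state s (x, y, w)) (w, rec_state s (x, y, q))"
proof -
  have "(rotor_step ^^ nat (w - q)) (q, rec_state s (x, y, w)) = (w, rec_state s (x, y, q))"
    by (subst sweep_right) (use assms in \<open>auto simp: rec_state_def fun_eq_iff\<close>)
  then show ?thesis unfolding reaches_def by blast
qed

lemma reaches_left:
  assumes "x \<le> a" "a \<le> p" "p < y"
  shows "reaches (p, rec_state s (x, y, a)) (a - 1, rec_state s (x, y, p + 1))"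
proof -
  have "(rotor_step ^^ nat (p - a + 1)) (p, rec_state s (x, y, a)) =
      (a - 1, rec_state s (x, y, p + 1))"
    by (subst sweep_left) (use assms in \<open>auto simp: rec_state_def fun_eq_iff\<close>)
  then show ?thesis unfolding reaches_def by blast
qed

text \<open>As \<open>x < a\<close>, the site \<open>a - 1\<close> is occupied and labelled
  \<open>R\<close>, so the left sweep is reflected there. The sum of particle position and boundary
  is conserved.\<close>

lemma reaches_bounce:
  assumes "x < a" "a \<le> p" "p < y"
  shows "reaches (p, rec_state s (x, y, a)) (p + 1, rec_state s (x, y, a - 1))"
proof -
  have "reaches (p, rec_state s (x, y, a)) (a - 1, rec_state s (x, y, p + 1))"
    using assms by (intro reaches_left) auto
  also have "reaches \<dots> (p + 1, rec_state s (x, y, a - 1))"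
    using assms by (intro reaches_right) auto
  finally show ?thesis .
qed

lemma reaches_bounces:
  assumes "a \<le> p" "x \<le> a - int n" "p + int n \<le> y"
  shows "reaches (p, rec_state s (x, y, a)) (p + int n, rec_state s (x, y, a - int n))"
  using assms
proof (induction n)
  case 0
  then show ?case by (simp add: reaches_refl)
next
  case (Suc n)
  then have "reaches (p, rec_state s (x, y, a)) (p + int n, rec_state s (x, y, a - int n))"
    by simp
  also have "reaches \<dots> (p + int n + 1, rec_state s (x, y, a - int n - 1))"
    using Suc.prems by (intro reaches_bounce) auto
  finally show ?case by (simp add: algebra_simps)
qed

lemma reaches_turning_point:
  assumes "(x, y, z) \<in> rec_triples" "0 \<le> k" "z \<le> k" "x \<le> z - k" "k \<le> y"
  shows "reaches (0, rec_state s (x, y, z)) (k, rec_state s (x, y, z - k))"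
proof (cases "z \<le> 0")
  case True
  then show ?thesis
    using reaches_bounces[of z 0 x "nat k" y s] assms by auto
next
  case False
  \<comment> \<open>The particle starts on an \<open>R\<close> here. The first sweep exchanges
    \<open>0\<close> and \<open>z\<close>, so position plus boundary equals \<open>z\<close>, as in
    the other case.\<close>
  have "reaches (0, rec_state s (x, y, z)) (z, rec_state s (x, y, 0))"
    using False assms by (intro reaches_right) (auto simp: rec_triples_def)
  also have "reaches \<dots> (k, rec_state s (x, y, z - k))"
    using reaches_bounces[of 0 z x "nat (k - z)" y s] False assms by auto
  finally show ?thesis .
qed

section \<open>Exit from the occupied interval\<close>

lemma dom_rotor_step: "dom (snd (rotor_step c)) = dom (snd c)"
  by (cases c) (auto split: option.splits label.splits)

lemma dom_rotor_steps: "dom (snd ((rotor_step ^^ n) c)) = dom (snd c)"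
  by (induction n) (simp_all add: dom_rotor_step)

lemma rotor_steps_outside:
  assumes "fst c \<notin> dom (snd c)"
  shows "(rotor_step ^^ n) c = c"
proof -
  have "rotor_step c = c" using assms by (cases c) (auto simp: domIff)
  then show ?thesis by (induction n) simp_all
qed

text \<open>The walk is stationary once outside the domain, so any outside configuration it reaches
  is already the one at the first exit.\<close>

lemma rotor_steps_exit_time:
  assumes "reaches (0, \<sigma>) (p, \<tau>)" "p \<notin> dom \<sigma>"
  shows "(rotor_step ^^ exit_time \<sigma>) (0, \<sigma>) = (p, \<tau>)"
proof -
  obtain n where n: "(rotor_step ^^ n) (0, \<sigma>) = (p, \<tau>)"
    using assms(1) unfolding reaches_def by blast
  let ?P = "\<lambda>n. fst ((rotor_step ^^ n) (0, \<sigma>)) \<notin> dom \<sigma>"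
  have "?P n" using n assms(2) by simp
  then have out: "?P (exit_time \<sigma>)" and le: "exit_time \<sigma> \<le> n"
    unfolding exit_time_def by (rule LeastI, rule Least_le)
  define c where "c = (rotor_step ^^ exit_time \<sigma>) (0, \<sigma>)"
  have "(rotor_step ^^ (n - exit_time \<sigma>)) c = c"
    using out dom_rotor_steps[of "exit_time \<sigma>" "(0, \<sigma>)"]
    unfolding c_def by (intro rotor_steps_outside) simp
  moreover have "(rotor_step ^^ (n - exit_time \<sigma>)) c = (rotor_step ^^ n) (0, \<sigma>)"
    using le funpow_add[of "n - exit_time \<sigma>" "exit_time \<sigma>" rotor_step]
    unfolding c_def by simp
  ultimately show ?thesis using n unfolding c_def by simp
qed

lemma rotor_map_right:
  assumes T: "(x, y, z) \<in> rec_triples" and "s > 0" and le: "x + y \<le> z"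
  shows "rotor_map r s (rec_state s (x, y, z)) = rec_state s (x, y + int s, z - y)"
proof -
  define \<tau> where
    "\<tau> = (\<lambda>q. if q \<in> {y..<y + int s} then Some L else rec_state s (x, y, z - y) q)"
  have bnds: "x \<le> 0" "0 \<le> y" "x \<le> z" "z \<le> y" using T by (auto simp: rec_triples_def)
  have "reaches (0, rec_state s (x, y, z)) (y, rec_state s (x, y, z - y))"
    using T le by (intro reaches_turning_point) (auto simp: rec_triples_def)
  \<comment> \<open>From \<open>y\<close> on all \<open>s\<close> labels are \<open>R\<close>: the
    particle runs through to \<open>y + int s\<close>, and the block of \<open>L\<close> starting at
    \<open>z - y\<close> now extends to \<open>y + int s - 1\<close>.\<close>
  also have "reaches \<dots> (y + int s, \<tau>)"
    unfolding reaches_def \<tau>_def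
    by (rule exI[of _ s], rule sweep_right) (use bnds in \<open>auto simp: rec_state_def\<close>)
  finally have "reaches (0, rec_state s (x, y, z)) (y + int s, \<tau>)" .
  then have "(rotor_step ^^ exit_time (rec_state s (x, y, z))) (0, rec_state s (x, y, z)) =
      (y + int s, \<tau>)"
    by (rule rotor_steps_exit_time) (simp add: dom_rec_state[OF T])
  moreover have "\<not> (\<forall>q\<in>dom (rec_state s (x, y, z)). y + int s < q)"
    using bnds \<open>s > 0\<close> unfolding dom_rec_state[OF T] by (auto intro!: bexI[of _ y])
  moreover have "occupy {y + int s .. y + int s + int s - 1} \<tau> = rec_state s (x, y + int s, z - y)"
    using bnds le by (auto simp: occupy_def \<tau>_def rec_state_def fun_eq_iff)
  ultimately show ?thesis unfolding rotor_map_def by (simp only: Let_def prod.case if_False)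
qed

lemma rotor_map_left:
  assumes T: "(x, y, z) \<in> rec_triples" and "s > 0" and gt: "x + y > z"
  shows "rotor_map r s (rec_state s (x, y, z)) = rec_state s (x - int r, y, z - x + 1)"
proof -
  have bnds: "x \<le> 0" "0 \<le> y" "x \<le> z" "z \<le> y" using T by (auto simp: rec_triples_def)
  \<comment> \<open>At the turning point \<open>z - x\<close>, which is below \<open>y\<close>, the
    first \<open>L\<close> is at the left end \<open>x\<close>. The next left sweep therefore meets
    no \<open>R\<close> and exits at \<open>x - 1\<close>.\<close>
  have "reaches (0, rec_state s (x, y, z)) (z - x, rec_state s (x, y, z - (z - x)))"
    using T gt by (intro reaches_turning_point) (auto simp: rec_triples_def)
  also have "reaches \<dots> (z - (z - x) - 1, rec_state s (x, y, z - x + 1))"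
    using bnds gt by (intro reaches_left) auto
  finally have "reaches (0, rec_state s (x, y, z)) (x - 1, rec_state s (x, y, z - x + 1))"
    by simp
  then have "(rotor_step ^^ exit_time (rec_state s (x, y, z))) (0, rec_state s (x, y, z)) =
      (x - 1, rec_state s (x, y, z - x + 1))"
    by (rule rotor_steps_exit_time) (simp add: dom_rec_state[OF T])
  moreover have "\<forall>q\<in>dom (rec_state s (x, y, z)). x - 1 < q"
    unfolding dom_rec_state[OF T] by auto
  moreover have "occupy {x - 1 - int r + 1 .. x - 1} (rec_state s (x, y, z - x + 1)) =
      rec_state s (x - int r, y, z - x + 1)"
    using bnds gt by (auto simp: occupy_def rec_state_def fun_eq_iff)
  ultimately show ?thesis by (simp add: rotor_map_def)
qed

section \<open>The map on triples and its invariant\<close>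

definition triple_map :: "nat \<Rightarrow> nat \<Rightarrow> int \<times> int \<times> int \<Rightarrow> int \<times> int \<times> int" where
  "triple_map r s = (\<lambda>(x, y, z).
     if x + y \<le> z then (x, y + int s, z - y) else (x - int r, y, z - x + 1))"

lemma triple_map_in_rec_triples:
  "T \<in> rec_triples \<Longrightarrow> triple_map r s T \<in> rec_triples"
  by (cases T) (auto simp: triple_map_def rec_triples_def)

lemma rotor_map_rec_state:
  assumes "T \<in> rec_triples" "s > 0"
  shows "rotor_map r s (rec_state s T) = rec_state s (triple_map r s T)"
  using assms rotor_map_right rotor_map_left by (cases T) (auto simp: triple_map_def)

definition rotor_invariant :: "nat \<Rightarrow> nat \<Rightarrow> int \<times> int \<times> int \<Rightarrow> int" where
  "rotor_invariant r s = (\<lambda>(x, y, z).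
     2 * int r * int s * z + int r * y\<^sup>2 - int r * int s * y
     - int s * x\<^sup>2 + 2 * int s * x - int r * int s * x)"

text \<open>The change of the square cancels the others; for a right step,
  \<open>- 2*r*s*y + r*(2*s*y + s^2) - r*s^2 = 0\<close>.\<close>

lemma rotor_invariant_triple_map: "rotor_invariant r s (triple_map r s T) = rotor_invariant r s T"
  by (cases T) (auto simp: rotor_invariant_def triple_map_def power2_eq_square algebra_simps)

section \<open>Asymptotic bounds by division by a growing factor\<close>

lemma asymptotic_upper_bound:
  fixes u S :: "nat \<Rightarrow> real"
  assumes S: "\<And>t. real t \<le> S t"
    and uS: "\<And>t. u t * S t \<le> C + S t * U + u t * d"
    and "\<delta> > 0"
  shows "\<exists>N. \<forall>t>N. u t < U + \<delta>"
proof -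
  \<comment> \<open>The hypothesis reads \<open>u * (S - d) \<le> C + S * U\<close>, so no prior
    bound on \<open>u\<close> is needed. The first bound on \<open>N\<close> makes
    \<open>S - d\<close> positive; the second contradicts
    \<open>S * \<delta> \<le> C + d * (U + \<delta>)\<close>, which
    \<open>u \<ge> U + \<delta>\<close> would force.\<close>
  obtain N :: nat where N: "real N > max d ((C + d * (U + \<delta>)) / \<delta>)"
    using reals_Archimedean2 by blast
  have "u t < U + \<delta>" if "t > N" for t
  proof (rule ccontr)
    assume "\<not> u t < U + \<delta>"
    moreover have big: "S t > d" "S t > (C + d * (U + \<delta>)) / \<delta>"
      using N S[of t] that by auto
    ultimately have "(U + \<delta>) * (S t - d) \<le> u t * (S t - d)"
      by (intro mult_right_mono) auto
    also have "\<dots> \<le> C + S t * U"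
      using uS[of t] by (simp add: algebra_simps)
    finally have "S t * \<delta> \<le> C + d * (U + \<delta>)" by (simp add: algebra_simps)
    then show False using big(2) \<open>\<delta> > 0\<close> by (simp add: field_simps)
  qed
  then show ?thesis by blast
qed

lemma eventually_bounded_imp_bounded:
  fixes f :: "nat \<Rightarrow> real"
  assumes "\<And>t. t > N \<Longrightarrow> \<bar>f t\<bar> \<le> K"
  shows "\<exists>B. \<forall>t. \<bar>f t\<bar> \<le> B"
proof (intro exI allI)
  fix t
  have fin: "finite ((\<lambda>t. \<bar>f t\<bar>) ` {..N})" by simp
  show "\<bar>f t\<bar> \<le> max K (Max ((\<lambda>t. \<bar>f t\<bar>) ` {..N}))"
    using assms[of t] Max_ge[OF fin, of "\<bar>f t\<bar>"] by (cases "t > N") (auto simp: le_max_iff_disj)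
qed

theorem theorem3p1:
  fixes r s :: nat
    and \<sigma> :: "nat \<Rightarrow> state"
    and x y z :: "nat \<Rightarrow> int"
  assumes "r > 0" and "s > 0"
    and "\<sigma> 0 \<in> Rec s"
    and "\<And>t. \<sigma> (Suc t) = rotor_map r s (\<sigma> t)"
    and "\<And>t. (x t, y t, z t) = rec_coords s (\<sigma> t)"
  shows "(\<forall>t. \<sigma> t \<in> Rec s) \<and>
    (\<exists>B. \<forall>t. \<bar>real_of_int (x t) * sqrt (real s) + real_of_int (y t) * sqrt (real r)\<bar> \<le> B) \<and>
    (\<forall>\<epsilon>>0. \<exists>N. \<forall>t>N.
       - (((real r - 2) * sqrt (real s) + real s * sqrt (real r) + \<epsilon>) / 2)
         < real_of_int (x t) * sqrt (real s) + real_of_int (y t) * sqrt (real r) \<and>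
       real_of_int (x t) * sqrt (real s) + real_of_int (y t) * sqrt (real r)
         < ((real r + 2) * sqrt (real s) + real s * sqrt (real r) + \<epsilon>) / 2)"
proof -
  \<comment> \<open>\<open>rec_coords\<close> inverts the encoding only on the image of
    \<open>rec_triples\<close>, so the induction carries membership along.\<close>
  have traj: "\<sigma> t = rec_state s (x t, y t, z t) \<and> (x t, y t, z t) \<in> rec_triples" for t
  proof (induction t)
    case 0
    then show ?case
      using assms(3) assms(5)[of 0] \<open>s > 0\<close> by (auto simp: Rec_def rec_coords_rec_state)
  next
    case (Suc t)
    then show ?case
      using assms(4)[of t] assms(5)[of "Suc t"] \<open>s > 0\<close>
      by (simp add: rotor_map_rec_state rec_coords_rec_state triple_map_in_rec_triples)
  qed
  then have bnds: "x t \<le> 0" "0 \<le> y t" "x t \<le> z t" "z t \<le> y t" for t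
    by (auto simp: rec_triples_def)
  have step: "(x (Suc t), y (Suc t), z (Suc t)) = triple_map r s (x t, y t, z t)" for t
    using assms(4)[of t] assms(5)[of "Suc t"] traj[of t] \<open>s > 0\<close>
    by (simp add: rotor_map_rec_state rec_coords_rec_state triple_map_in_rec_triples)
  have J: "rotor_invariant r s (x t, y t, z t) = rotor_invariant r s (x 0, y 0, z 0)" for t
    by (induction t) (simp_all add: step rotor_invariant_triple_map)
  define C where "C = real_of_int (rotor_invariant r s (x 0, y 0, z 0))"
  define a b where "a = sqrt (real r)" and "b = sqrt (real s)"
  have a: "a \<ge> 1" "real r = a\<^sup>2" and b: "b \<ge> 1" "real s = b\<^sup>2"
    using assms(1,2) by (auto simp: a_def b_def)
  have ab: "1 \<le> a\<^sup>2 * b" "1 \<le> b\<^sup>2 * a"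
    using a(1) b(1) mult_mono[of 1 "a\<^sup>2" 1 b] mult_mono[of 1 "b\<^sup>2" 1 a] by simp_all
  define X Y Z where "X t = real_of_int (x t)" and "Y t = real_of_int (y t)"
    and "Z t = real_of_int (z t)" for t
  define u S where "u t = X t * b + Y t * a" and "S t = Y t * a - X t * b" for t
  have bR: "X t \<le> 0" "0 \<le> Y t" "X t \<le> Z t" "Z t \<le> Y t" for t
    using bnds[of t] by (auto simp: X_def Y_def Z_def)
  \<comment> \<open>\<open>S\<close> starts nonnegative, and each step adds
    \<open>b\<^sup>2 * a\<close> or \<open>a\<^sup>2 * b\<close>, both at least 1.\<close>
  have S: "real t \<le> S t" for t
  proof (induction t)
    case 0
    have "X 0 * b \<le> 0" "0 \<le> Y 0 * a"
      using bR[of 0] a(1) b(1) by (auto simp: mult_le_0_iff)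
    then show ?case by (simp add: S_def)
  next
    case (Suc t)
    have "(X (Suc t) = X t \<and> Y (Suc t) = Y t + b\<^sup>2) \<or> (X (Suc t) = X t - a\<^sup>2 \<and> Y (Suc t) = Y t)"
      using step[of t] unfolding X_def Y_def a(2)[symmetric] b(2)[symmetric]
      by (auto simp: triple_map_def split: if_splits)
    then have "S (Suc t) = S t + b\<^sup>2 * a \<or> S (Suc t) = S t + a\<^sup>2 * b"
      unfolding S_def by (elim disjE conjE) (simp_all only:, simp_all add: algebra_simps)
    then have "S t + 1 \<le> S (Suc t)" using ab by auto
    then show ?case using Suc by simp
  qed
  have inv: "u t * S t = C - 2 * a\<^sup>2 * b\<^sup>2 * Z t + a\<^sup>2 * b\<^sup>2 * Y t - 2 * b\<^sup>2 * X t + a\<^sup>2 * b\<^sup>2 * X t" for t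
  proof -
    have "C = 2 * a\<^sup>2 * b\<^sup>2 * Z t + a\<^sup>2 * (Y t)\<^sup>2 - a\<^sup>2 * b\<^sup>2 * Y t
        - b\<^sup>2 * (X t)\<^sup>2 + 2 * b\<^sup>2 * X t - a\<^sup>2 * b\<^sup>2 * X t"
      unfolding C_def J[of t, symmetric] X_def Y_def Z_def a(2)[symmetric] b(2)[symmetric]
      by (simp add: rotor_invariant_def)
    then show ?thesis by (simp add: u_def S_def power2_eq_square algebra_simps)
  qed
  \<comment> \<open>Substituting \<open>X = (u - S) / (2 * b)\<close> and
    \<open>Y = (u + S) / (2 * a)\<close> after replacing \<open>Z\<close> by \<open>X\<close> or
    \<open>Y\<close> leaves expressions linear in \<open>S\<close> and \<open>u\<close>.
    \<open>U\<close> and \<open>V\<close> are the coefficients of \<open>S\<close> in the bounds for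
    \<open>u * S\<close> and \<open>- u * S\<close>.\<close>
  define U V where "U = ((a\<^sup>2 + 2) * b + b\<^sup>2 * a) / 2" and "V = ((a\<^sup>2 - 2) * b + b\<^sup>2 * a) / 2"
  have upper: "u t * S t \<le> C + S t * U + u t * ((b\<^sup>2 * a - a\<^sup>2 * b - 2 * b) / 2)" for t
  proof -
    have "a\<^sup>2 * b\<^sup>2 * X t \<le> a\<^sup>2 * b\<^sup>2 * Z t"
      using bR[of t] by (intro mult_left_mono) auto
    moreover have "S t * U + u t * ((b\<^sup>2 * a - a\<^sup>2 * b - 2 * b) / 2) =
        a\<^sup>2 * b\<^sup>2 * Y t - a\<^sup>2 * b\<^sup>2 * X t - 2 * b\<^sup>2 * X t"
      by (simp add: U_def S_def u_def field_simps power2_eq_square)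
    ultimately show ?thesis unfolding inv by linarith
  qed
  \<comment> \<open>The lower bound is an upper bound for \<open>- u\<close>. Negation flips the
    sign of \<open>2 * b\<^sup>2 * X\<close>, which is why \<open>V\<close> has
    \<open>a\<^sup>2 - 2\<close> where \<open>U\<close> has \<open>a\<^sup>2 + 2\<close>.\<close>
  have lower: "- u t * S t \<le> - C + S t * V + - u t * ((a\<^sup>2 * b - b\<^sup>2 * a - 2 * b) / 2)" for t
  proof -
    have "a\<^sup>2 * b\<^sup>2 * Z t \<le> a\<^sup>2 * b\<^sup>2 * Y t"
      using bR[of t] by (intro mult_left_mono) auto
    moreover have "S t * V + - u t * ((a\<^sup>2 * b - b\<^sup>2 * a - 2 * b) / 2) =
        a\<^sup>2 * b\<^sup>2 * Y t - a\<^sup>2 * b\<^sup>2 * X t + 2 * b\<^sup>2 * X t"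
      by (simp add: V_def S_def u_def field_simps power2_eq_square)
    moreover have "- u t * S t = - (u t * S t)" by simp
    ultimately show ?thesis unfolding inv by linarith
  qed
  have asymp: "\<exists>N. \<forall>t>N. - (V + \<epsilon> / 2) < u t \<and> u t < U + \<epsilon> / 2" if pos: "\<epsilon> > 0" for \<epsilon>
  proof -
    obtain M where M: "\<forall>t>M. u t < U + \<epsilon> / 2"
      using asymptotic_upper_bound[of S u, OF S upper, of "\<epsilon> / 2"] pos by auto
    obtain N where N: "\<forall>t>N. - u t < V + \<epsilon> / 2"
      using asymptotic_upper_bound[of S "\<lambda>t. - u t", OF S lower, of "\<epsilon> / 2"] pos by auto
    show ?thesis
      using M N by (intro exI[of _ "max M N"]) (auto simp: minus_less_iff)
  qed
  have "\<exists>B. \<forall>t. \<bar>u t\<bar> \<le> B"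
  proof -
    obtain N where "\<forall>t>N. - (V + 1 / 2) < u t \<and> u t < U + 1 / 2"
      using asymp[of 1] by auto
    then show ?thesis
      by (intro eventually_bounded_imp_bounded[of N u "\<bar>U\<bar> + \<bar>V\<bar> + 1"]) fastforce
  qed
  moreover have "\<sigma> t \<in> Rec s" for t using traj[of t] by (auto simp: Rec_def)
  moreover have "\<exists>N. \<forall>t>N. - (((real r - 2) * b + real s * a + \<epsilon>) / 2) < u t \<and>
      u t < ((real r + 2) * b + real s * a + \<epsilon>) / 2" if "\<epsilon> > 0" for \<epsilon>
    using asymp[OF that] by (simp add: U_def V_def a(2) b(2) add_divide_distrib)
  ultimately show ?thesis
    unfolding u_def X_def Y_def a_def b_def by blast
qed

end
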